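(* The T-Drazin inverse preserves similarity: let $\mathcal{A},\mathcal{B}\in\mathbb{C}^{n\times n\times p}$ be complex tensors. If $\mathcal{X}\in\mathbb{C}^{n\times n\times p}$ is a nonsingular (invertible) tensor and $$\mathcal{A}=\mathcal{X}^{-1}*\mathcal{B}*\mathcal{X},$$ then $$\mathcal{A}^D=\mathcal{X}^{-1}*\mathcal{B}^D*\mathcal{X},\qquad \mathcal{A}^D*(\mathcal{A}^D)^{\#}=\mathcal{A}*\mathcal{A}^D.$$
   Context: For $\mathcal{A}\in\mathbb{C}^{m\times n\times p}$ let $A^{(1)},\dots,A^{(p)}\in\mathbb{C}^{m\times n}$ be its frontal slices. $\mathrm{bcirc}(\mathcal{A})$ is the $mp\times np$ block circulant matrix whose $(i,j)$ block ($1\le i,j\le p$) is $A^{(((i-j)\bmod p)+1)}$; $\mathrm{unfold}(\mathcal{A})$ is the $mp\times n$ matrix obtained by stacking $A^{(1)},\dots,A^{(p)}$ vertically, and $\mathrm{fold}$ is the inverse of $\mathrm{unfold}$. The T-product is $\mathcal{A}*\mathcal{B}=\mathrm{fold}(\mathrm{bcirc}(\mathcal{A})\,\mathrm{unfold}(\mathcal{B}))$; powers and inverses are with respect to $*$ and the identity tensor $\mathcal{I}$ (first frontal slice $I_n$, other slices zero). The index $\mathrm{Ind}(A)$ of a square matrix $A$ is the smallest positive integer $k$ with $\mathrm{rank}(A^k)=\mathrm{rank}(A^{k+1})$, and $\mathrm{Ind}_T(\mathcal{A})=\mathrm{Ind}(\mathrm{bcirc}(\mathcal{A}))$. The T-Drazin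 inverse $\mathcal{A}^D$ is the unique $\mathcal{Y}\in\mathbb{C}^{n\times n\times p}$ with $\mathcal{A}^k*\mathcal{Y}*\mathcal{A}=\mathcal{A}^k$, $\mathcal{Y}*\mathcal{A}*\mathcal{Y}=\mathcal{Y}$, $\mathcal{A}*\mathcal{Y}=\mathcal{Y}*\mathcal{A}$, where $k=\mathrm{Ind}_T(\mathcal{A})$. The T-group inverse $\mathcal{A}^{\#}$ is the unique $\mathcal{Y}$ (when it exists) with $\mathcal{A}*\mathcal{Y}*\mathcal{A}=\mathcal{A}$, $\mathcal{Y}*\mathcal{A}*\mathcal{Y}=\mathcal{Y}$, $\mathcal{A}*\mathcal{Y}=\mathcal{Y}*\mathcal{A}$. *)

theory Defs
  imports "Jordan_Normal_Form.DL_Rank"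
begin

(* A third-order tensor is the list of its frontal slices; slices, rows and columns are
   counted from 0, so the slice written A^(k) on paper is A ! (k - 1). *)
type_synonym tensor = "complex mat list"

definition carrier_tensor :: "nat \<Rightarrow> nat \<Rightarrow> nat \<Rightarrow> tensor set" where
  "carrier_tensor m n p = {A. length A = p \<and> set A \<subseteq> carrier_mat m n}"

(* The slice sizes are read off the first slice, so p > 0 is needed for them to be meaningful. *)
definition t_rows :: "tensor \<Rightarrow> nat" where
  "t_rows A = dim_row (hd A)"

definition t_cols :: "tensor \<Rightarrow> nat" where
  "t_cols A = dim_col (hd A)"

definition bcirc :: "tensor \<Rightarrow> complex mat" where
  "bcirc A = (let m = t_rows A; n = t_cols A; p = length A in
     mat (m * p) (n * p) (\<lambda>(i, j).
       (A ! nat ((int (i div m) - int (j div n)) mod int p)) $$ (i mod m, j mod n)))"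

definition t_unfold :: "tensor \<Rightarrow> complex mat" where
  "t_unfold A = (let m = t_rows A; n = t_cols A; p = length A in
     mat (m * p) n (\<lambda>(i, j). (A ! (i div m)) $$ (i mod m, j)))"

definition t_fold :: "nat \<Rightarrow> nat \<Rightarrow> complex mat \<Rightarrow> tensor" where
  "t_fold m p M = map (\<lambda>k. mat m (dim_col M) (\<lambda>(i, j). M $$ (k * m + i, j))) [0..<p]"

lemma t_fold_unfold:
  assumes A: "A \<in> carrier_tensor m n p" and p: "0 < p"
  shows "t_fold m p (t_unfold A) = A"
proof -
  have len: "length A = p" and car: "\<And>k. k < p \<Longrightarrow> A ! k \<in> carrier_mat m n"
    using A by (auto simp: carrier_tensor_def)
  have hd: "hd A = A ! 0" using len p by (cases A) auto
  have r: "t_rows A = m" and c: "t_cols A = n"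
    using car[OF p] by (auto simp: t_rows_def t_cols_def hd)
  have bound: "k * m + i < m * p" if "k < p" "i < m" for k i
  proof -
    have "k * m + i < Suc k * m" using that by simp
    also have "\<dots> \<le> p * m" using that by (intro mult_le_mono1) simp
    finally show ?thesis by (simp add: mult.commute)
  qed
  show ?thesis
  proof (rule nth_equalityI)
    fix k assume "k < length (t_fold m p (t_unfold A))"
    then have k: "k < p" by (simp add: t_fold_def)
    show "t_fold m p (t_unfold A) ! k = A ! k"
      using car[OF k] k bound[OF k]
      by (intro eq_matI) (auto simp: t_fold_def t_unfold_def Let_def r c len)
  qed (simp add: t_fold_def len)
qed

lemma t_unfold_fold:
  assumes M: "M \<in> carrier_mat (m * p) n" and p: "0 < p"
  shows "t_unfold (t_fold m p M) = M"
proof -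
  have hd: "hd (t_fold m p M) = mat m (dim_col M) (\<lambda>(i, j). M $$ (0 * m + i, j))"
    using p by (simp add: t_fold_def upt_conv_Cons)
  have d: "i div m < p \<and> i mod m < m" if "i < m * p" for i
    using that by (cases "m = 0") (auto simp: less_mult_imp_div_less mult.commute)
  show ?thesis
    using M d by (intro eq_matI)
      (auto simp: t_unfold_def Let_def t_rows_def t_cols_def hd, auto simp: t_fold_def)
qed

definition t_prod :: "tensor \<Rightarrow> tensor \<Rightarrow> tensor" (infixl "*\<^sub>T" 70) where
  "A *\<^sub>T B = t_fold (t_rows A) (length A) (bcirc A * t_unfold B)"

definition t_one :: "nat \<Rightarrow> nat \<Rightarrow> tensor" where
  "t_one n p = map (\<lambda>k. if k = 0 then 1\<^sub>m n else 0\<^sub>m n n) [0..<p]"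

definition t_monoid :: "nat \<Rightarrow> nat \<Rightarrow> tensor monoid" where
  "t_monoid n p = \<lparr>carrier = carrier_tensor n n p, mult = (*\<^sub>T), one = t_one n p\<rparr>"

definition mat_index :: "complex mat \<Rightarrow> nat" where
  "mat_index M = (LEAST k. 0 < k \<and>
     vec_space.rank (dim_row M) (M ^\<^sub>m k) = vec_space.rank (dim_row M) (M ^\<^sub>m (k + 1)))"

definition t_index :: "tensor \<Rightarrow> nat" where
  "t_index A = mat_index (bcirc A)"

definition is_t_drazin :: "nat \<Rightarrow> nat \<Rightarrow> tensor \<Rightarrow> tensor \<Rightarrow> bool" where
  "is_t_drazin n p A Y \<longleftrightarrow> Y \<in> carrier_tensor n n p \<and>
     (let Ak = A [^]\<^bsub>t_monoid n p\<^esub> t_index A in Ak *\<^sub>T Y *\<^sub>T A = Ak) \<and>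
     Y *\<^sub>T A *\<^sub>T Y = Y \<and>
     A *\<^sub>T Y = Y *\<^sub>T A"

definition t_drazin :: "nat \<Rightarrow> nat \<Rightarrow> tensor \<Rightarrow> tensor" where
  "t_drazin n p A = (THE Y. is_t_drazin n p A Y)"

definition is_t_group_inverse :: "nat \<Rightarrow> nat \<Rightarrow> tensor \<Rightarrow> tensor \<Rightarrow> bool" where
  "is_t_group_inverse n p A Y \<longleftrightarrow> Y \<in> carrier_tensor n n p \<and>
     A *\<^sub>T Y *\<^sub>T A = A \<and>
     Y *\<^sub>T A *\<^sub>T Y = Y \<and>
     A *\<^sub>T Y = Y *\<^sub>T A"

definition t_group_inverse :: "nat \<Rightarrow> nat \<Rightarrow> tensor \<Rightarrow> tensor" where
  "t_group_inverse n p A = (THE Y. is_t_group_inverse n p A Y)"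

end

theory Submission
  imports Defs
begin

text \<open>
  The T-product is block circulant matrix multiplication in disguise: \<open>bcirc\<close> is an injective
  unital multiplicative map from the \<open>n \<times> n \<times> p\<close> tensors into the \<open>np \<times> np\<close> matrices
  (\<open>bcirc_t_prod\<close>, \<open>inj_on_bcirc\<close>). Hence tensors form a monoid, and everything that has to be
  said about T-Drazin inverses is a statement about one element of a monoid.

  In a monoid an element has at most one Drazin inverse, even when the two candidates satisfy the
  defining equation \<open>a\<^sup>k y a = a\<^sup>k\<close> with different exponents \<open>k\<close>
  (\<open>drazin_inverse_unique\<close>). Conjugation by a unit is a monoid endomorphism, so it carries the
  Drazin inverse of \<open>B\<close> to a Drazin inverse of \<open>A = X\<^sup>-\<^sup>1 B X\<close>, with the index of \<open>B\<close> as
  exponent; uniqueness across exponents identifies it with the Drazin inverse of \<open>A\<close>.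
  Similarly \<open>a\<^sup>2 y\<close> is the group inverse of the Drazin inverse \<open>y\<close> of \<open>a\<close>, and
  \<open>y (a\<^sup>2 y) = a y\<close>.

  What remains is existence, since the T-Drazin inverse is a definite description. For a matrix
  \<open>M\<close> of index \<open>k\<close>, equality of the ranks of \<open>M\<^sup>k\<close> and \<open>M\<^sup>k\<^sup>+\<^sup>1\<close> means equality of their column
  spaces, so \<open>M\<^sup>k\<close> is a right multiple of \<open>M\<^sup>k\<^sup>+\<^sup>1\<close>; the same applied to the transpose makes
  some power \<open>M\<^sup>l\<close> a left multiple of \<open>M\<^sup>l\<^sup>+\<^sup>1\<close>. These two facts yield a Drazin inverse in any
  monoid (\<open>drazin_inverse_exists\<close>). To see that the Drazin inverse of a block circulant matrix is
  again block circulant, and so comes from a tensor, observe that block circulant matrices are the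
  fixed points of a multiplicative map, the simultaneous cyclic shift of block rows and block
  columns. The shift sends the Drazin inverse of a fixed matrix to a Drazin inverse of that same
  matrix, so by uniqueness the Drazin inverse is fixed as well.
\<close>

section \<open>Drazin inverses in a monoid\<close>

text \<open>
  The exponent is a parameter and not the index of \<open>a\<close>: with exponent 1 this is the group inverse,
  and statements that mix exponents become available.
\<close>

definition drazin_inverse :: "('a, 'b) monoid_scheme \<Rightarrow> nat \<Rightarrow> 'a \<Rightarrow> 'a \<Rightarrow> bool" where
  "drazin_inverse G k a y \<longleftrightarrow> y \<in> carrier G \<and>
     a [^]\<^bsub>G\<^esub> k \<otimes>\<^bsub>G\<^esub> y \<otimes>\<^bsub>G\<^esub> a = a [^]\<^bsub>G\<^esub> k \<and>
     y \<otimes>\<^bsub>G\<^esub> a \<otimes>\<^bsub>G\<^esub> y = y \<and>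
     a \<otimes>\<^bsub>G\<^esub> y = y \<otimes>\<^bsub>G\<^esub> a"

lemma hom_nat_pow_one:
  assumes "monoid G" "monoid H" "h \<in> hom G H" "h \<one>\<^bsub>G\<^esub> = \<one>\<^bsub>H\<^esub>" "a \<in> carrier G"
  shows "h (a [^]\<^bsub>G\<^esub> (k::nat)) = h a [^]\<^bsub>H\<^esub> k"
proof -
  interpret G: monoid G by fact
  show ?thesis using assms(3-5) by (induction k) (auto simp: hom_mult)
qed

lemma drazin_inverse_hom:
  assumes "monoid G" "monoid H" and h: "h \<in> hom G H" "h \<one>\<^bsub>G\<^esub> = \<one>\<^bsub>H\<^esub>"
    and a: "a \<in> carrier G" and y: "drazin_inverse G k a y"
  shows "drazin_inverse H k (h a) (h y)"
proof -
  interpret G: monoid G by fact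
  have yc: "y \<in> carrier G" using y by (simp add: drazin_inverse_def)
  note pow = hom_nat_pow_one[OF assms(1-5), symmetric]
  show ?thesis
    using y a yc h(1)
    by (simp add: drazin_inverse_def pow hom_mult[OF h(1), symmetric] hom_in_carrier)
qed

lemma drazin_inverse_hom_iff:
  assumes "monoid G" "monoid H" and h: "h \<in> hom G H" "h \<one>\<^bsub>G\<^esub> = \<one>\<^bsub>H\<^esub>"
    and inj: "inj_on h (carrier G)" and a: "a \<in> carrier G" and y: "y \<in> carrier G"
  shows "drazin_inverse H k (h a) (h y) \<longleftrightarrow> drazin_inverse G k a y"
proof -
  interpret G: monoid G by fact
  note pow = hom_nat_pow_one[OF assms(1-4) a, symmetric]
  show ?thesis
    using a y h(1)
    by (simp add: drazin_inverse_def pow hom_mult[OF h(1), symmetric] hom_in_carrier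
        inj_on_eq_iff[OF inj])
qed

lemma (in monoid) drazin_inverse_mono:
  assumes a: "a \<in> carrier G" and y: "drazin_inverse G k a y" and "k \<le> m"
  shows "drazin_inverse G m a y"
proof -
  have yc: "y \<in> carrier G" and k: "a [^] k \<otimes> y \<otimes> a = a [^] k"
    using y by (auto simp: drazin_inverse_def)
  obtain d where m: "m = d + k" using \<open>k \<le> m\<close> le_Suc_ex by (metis add.commute)
  have "a [^] m \<otimes> y \<otimes> a = a [^] d \<otimes> (a [^] k \<otimes> y \<otimes> a)"
    using a yc by (simp add: m nat_pow_mult[symmetric] m_assoc)
  also have "\<dots> = a [^] m" using a by (simp add: k m nat_pow_mult)
  finally show ?thesis using y by (simp add: drazin_inverse_def)
qed

text \<open>
  Since \<open>y\<close> commutes with \<open>a\<close> and absorbs \<open>a y\<close>, it absorbs every power of \<open>a y\<close>. This lets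
  \<open>y\<close> display as high a power of \<open>a\<close> as an argument requires.
\<close>

lemma (in monoid) drazin_inverse_factor:
  assumes a: "a \<in> carrier G" and y: "drazin_inverse G k a y"
  shows "y [^] Suc j \<otimes> a [^] j = y" "a [^] j \<otimes> y [^] Suc j = y"
proof -
  have yc: "y \<in> carrier G" and yay: "y \<otimes> a \<otimes> y = y" and ay: "a \<otimes> y = y \<otimes> a"
    using y by (auto simp: drazin_inverse_def)
  have yya: "y \<otimes> (y \<otimes> a) = y" "a \<otimes> y \<otimes> y = y"
    using yay ay a yc by (metis m_assoc)+
  show "y [^] Suc j \<otimes> a [^] j = y"
  proof (induction j)
    case 0 show ?case using yc by simp
  next
    case (Suc j)
    have "y [^] Suc (Suc j) \<otimes> a [^] Suc j = y \<otimes> ((y [^] Suc j \<otimes> a [^] j) \<otimes> a)"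
      using a yc by (subst nat_pow_Suc2) (simp_all add: m_assoc)
    also have "\<dots> = y" by (simp only: Suc yya)
    finally show ?case .
  qed
  show "a [^] j \<otimes> y [^] Suc j = y"
  proof (induction j)
    case 0 show ?case using yc by simp
  next
    case (Suc j)
    have "a [^] Suc j \<otimes> y [^] Suc (Suc j) = (a \<otimes> (a [^] j \<otimes> y [^] Suc j)) \<otimes> y"
      using a yc by (subst nat_pow_Suc2) (simp_all add: m_assoc)
    also have "\<dots> = y" by (simp only: Suc yya)
    finally show ?case .
  qed
qed

text \<open>
  For \<open>m\<close> above both exponents, \<open>a\<^sup>m z a = a\<^sup>m = y a a\<^sup>m\<close>. Splitting \<open>a\<^sup>m\<close> off \<open>y\<close> on the right
  therefore gives \<open>y = y a z\<close>, and splitting it off \<open>z\<close> on the left gives \<open>z = y a z\<close>.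
\<close>

lemma (in monoid) drazin_inverse_unique:
  assumes a: "a \<in> carrier G" and y: "drazin_inverse G k a y" and z: "drazin_inverse G l a z"
  shows "y = z"
proof -
  define m where "m = max k l"
  have ym: "drazin_inverse G m a y" and zm: "drazin_inverse G m a z"
    using drazin_inverse_mono[OF a y] drazin_inverse_mono[OF a z] by (simp_all add: m_def)
  have yc: "y \<in> carrier G" and zc: "z \<in> carrier G"
    and pow: "a [^] m \<otimes> y \<otimes> a = a [^] m" "a [^] m \<otimes> z \<otimes> a = a [^] m"
    and ay: "a \<otimes> y = y \<otimes> a" and az: "a \<otimes> z = z \<otimes> a"
    using ym zm by (auto simp: drazin_inverse_def)
  note facy = drazin_inverse_factor(1)[OF a ym, of m] and facz = drazin_inverse_factor(2)[OF a zm, of m]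
  have comm: "a [^] m \<otimes> y = y \<otimes> a [^] m"
    using group_commutes_pow[OF ay a yc] .
  have "y = y [^] Suc m \<otimes> (a [^] m \<otimes> z \<otimes> a)" by (simp only: pow facy)
  also have "\<dots> = (y [^] Suc m \<otimes> a [^] m) \<otimes> (z \<otimes> a)"
    using a yc zc by (simp add: m_assoc)
  also have "\<dots> = y \<otimes> a \<otimes> z" using a yc zc by (simp only: facy) (simp add: m_assoc az)
  also have "\<dots> = (y \<otimes> a) \<otimes> (a [^] m \<otimes> z [^] Suc m)" by (simp only: facz)
  also have "\<dots> = (y \<otimes> (a \<otimes> a [^] m)) \<otimes> z [^] Suc m"
    using a yc zc by (simp add: m_assoc)
  also have "\<dots> = (a [^] m \<otimes> y \<otimes> a) \<otimes> z [^] Suc m"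
  proof -
    have "a \<otimes> a [^] m = a [^] m \<otimes> a" using nat_pow_Suc2[OF a, of m] by simp
    then show ?thesis using a yc zc by (simp add: m_assoc[symmetric] comm del: nat_pow_Suc)
  qed
  also have "\<dots> = z" by (simp only: pow facz)
  finally show ?thesis .
qed

text \<open>
  A relation \<open>a\<^sup>k\<^sup>+\<^sup>1 x = a\<^sup>k\<close> cancels one factor of \<open>a\<close> against one factor of \<open>x\<close> as long as at
  least \<open>k\<close> factors of \<open>a\<close> are left, and this can be iterated.
\<close>

lemma (in monoid) pow_absorb_right:
  assumes "a \<in> carrier G" "x \<in> carrier G" and "a [^] Suc k \<otimes> x = a [^] k" and "k \<le> m"
  shows "a [^] (m + j) \<otimes> x [^] (j::nat) = a [^] m"
proof (induction j)
  case 0 show ?case using assms by simp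
next
  case (Suc j)
  obtain d where d: "m + j = d + k" using \<open>k \<le> m\<close> le_Suc_ex by (metis add.commute trans_le_add1)
  have "a [^] (m + Suc j) = a [^] d \<otimes> a [^] Suc k"
    using assms(1) by (simp add: d nat_pow_mult[symmetric] m_assoc)
  then have "a [^] (m + Suc j) \<otimes> x [^] Suc j = (a [^] d \<otimes> a [^] Suc k) \<otimes> (x \<otimes> x [^] j)"
    by (simp only: nat_pow_Suc2[OF assms(2)])
  also have "\<dots> = a [^] d \<otimes> (a [^] Suc k \<otimes> x) \<otimes> x [^] j"
    using assms(1,2) by (simp add: m_assoc)
  also have "\<dots> = a [^] m" using assms(1) by (simp only: assms(3) nat_pow_mult d[symmetric] Suc)
  finally show ?case .
qed

lemma (in monoid) pow_absorb_left:
  assumes "a \<in> carrier G" "y \<in> carrier G" and "y \<otimes> a [^] Suc k = a [^] k" and "k \<le> m"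
  shows "y [^] (j::nat) \<otimes> a [^] (m + j) = a [^] m"
proof (induction j)
  case 0 show ?case using assms by simp
next
  case (Suc j)
  obtain d where d: "m + j = k + d" using \<open>k \<le> m\<close> le_Suc_ex by (metis add.assoc)
  have "a [^] (m + Suc j) = a [^] Suc k \<otimes> a [^] d"
  proof -
    have "m + Suc j = Suc k + d" using d by simp
    then show ?thesis using nat_pow_mult[OF assms(1), of "Suc k" d] by (simp only:)
  qed
  then have "y [^] Suc j \<otimes> a [^] (m + Suc j) = y [^] j \<otimes> ((y \<otimes> a [^] Suc k) \<otimes> a [^] d)"
    using assms(1,2) by (simp add: m_assoc)
  also have "\<dots> = a [^] m" using assms(1) by (simp only: assms(3) nat_pow_mult d[symmetric] Suc)
  finally show ?case .
qed

text \<open>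
  The inverse is \<open>c = a\<^sup>m x\<^sup>m\<^sup>+\<^sup>1\<close> for \<open>m = max k l\<close>. The role of commutativity is taken by
  \<open>a\<^sup>m x\<^sup>j = y\<^sup>j a\<^sup>m\<close>, which holds because both sides equal \<open>y\<^sup>j a\<^sup>m\<^sup>+\<^sup>j x\<^sup>j\<close>. Reading \<open>c\<close> from both
  sides shows that it commutes with \<open>a\<close>. The exponent is the one of the right-hand relation alone:
  \<open>a\<^sup>k = a\<^sup>m a\<^sup>k x\<^sup>m\<close>, so what \<open>c a\<close> fixes at \<open>a\<^sup>m\<close> it already fixes at \<open>a\<^sup>k\<close>.
\<close>

lemma (in monoid) drazin_inverse_exists:
  assumes a: "a \<in> carrier G" and x: "x \<in> carrier G" and y: "y \<in> carrier G"
    and ax: "a [^] Suc k \<otimes> x = a [^] k" and ya: "y \<otimes> a [^] Suc l = a [^] l"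
  shows "\<exists>c. drazin_inverse G k a c"
proof -
  define m where "m = max k l"
  have absx: "a [^] (m + j) \<otimes> x [^] j = a [^] m" for j :: nat
    using pow_absorb_right[OF a x ax, of m] by (simp add: m_def)
  have absy: "y [^] j \<otimes> a [^] (m + j) = a [^] m" for j :: nat
    using pow_absorb_left[OF a y ya, of m] by (simp add: m_def)
  have swap: "a [^] m \<otimes> x [^] j = y [^] j \<otimes> a [^] m" for j :: nat
  proof -
    have "y [^] j \<otimes> a [^] m = y [^] j \<otimes> (a [^] (m + j) \<otimes> x [^] j)" by (simp only: absx)
    also have "\<dots> = (y [^] j \<otimes> a [^] (m + j)) \<otimes> x [^] j" using a x y by (simp add: m_assoc)
    also have "\<dots> = a [^] m \<otimes> x [^] j" by (simp only: absy)
    finally show ?thesis by simp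
  qed
  define c where "c = a [^] m \<otimes> x [^] Suc m"
  have cy: "c = y [^] Suc m \<otimes> a [^] m" unfolding c_def by (rule swap)
  have cc: "c \<in> carrier G" using a x by (simp add: c_def)
  have ac: "a \<otimes> c = a [^] m \<otimes> x [^] m"
  proof -
    have "a \<otimes> a [^] m = a [^] m \<otimes> a" using nat_pow_Suc2[OF a, of m] by simp
    moreover have "x [^] Suc m = x \<otimes> x [^] m" by (rule nat_pow_Suc2[OF x])
    ultimately have "a \<otimes> c = (a [^] m \<otimes> a \<otimes> x) \<otimes> x [^] m"
      unfolding c_def using a x by (simp add: m_assoc[symmetric] del: nat_pow_Suc)
    moreover have "a [^] m \<otimes> a \<otimes> x = a [^] m" using absx[of 1] x by simp
    ultimately show ?thesis by simp
  qed
  have ca: "c \<otimes> a = a [^] m \<otimes> x [^] m"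
  proof -
    have "c \<otimes> a = y [^] m \<otimes> (y \<otimes> (a [^] m \<otimes> a))"
      unfolding cy using a y by (simp add: m_assoc)
    moreover have "y \<otimes> (a [^] m \<otimes> a) = a [^] m" using absy[of 1] y by simp
    ultimately show ?thesis by (simp only: swap)
  qed
  have comm: "a \<otimes> c = c \<otimes> a" by (simp add: ac ca)
  have pow_m: "c \<otimes> a \<otimes> a [^] m = a [^] m"
  proof -
    have "c \<otimes> a \<otimes> a [^] m = y [^] m \<otimes> a [^] (m + m)"
      using a y by (simp add: ca swap m_assoc nat_pow_mult)
    then show ?thesis by (simp only: absy)
  qed
  have cac: "c \<otimes> a \<otimes> c = c"
  proof -
    have "c \<otimes> a \<otimes> c = (c \<otimes> a \<otimes> a [^] m) \<otimes> x [^] Suc m"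
      using a x cc by (subst (2) c_def) (simp add: m_assoc)
    also have "\<dots> = c" by (simp only: pow_m c_def[symmetric])
    finally show ?thesis .
  qed
  have "a [^] k \<otimes> c \<otimes> a = a [^] k"
  proof -
    have cak: "a [^] k \<otimes> c = c \<otimes> a [^] k"
      using group_commutes_pow[OF comm a cc] .
    have "a [^] k = a [^] (m + k) \<otimes> x [^] m"
      using pow_absorb_right[OF a x ax order.refl, of m] by (simp add: add.commute)
    then have fac: "a [^] k = a [^] m \<otimes> (a [^] k \<otimes> x [^] m)"
      using a x by (simp add: nat_pow_mult[symmetric] m_assoc)
    have "a [^] k \<otimes> c \<otimes> a = c \<otimes> a \<otimes> a [^] k"
      using a cc by (simp add: cak m_assoc nat_pow_Suc2[symmetric] del: nat_pow_Suc)
    also have "\<dots> = (c \<otimes> a \<otimes> a [^] m) \<otimes> (a [^] k \<otimes> x [^] m)"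
      using a x cc by (subst fac) (simp add: m_assoc)
    also have "\<dots> = a [^] k" by (simp only: pow_m fac[symmetric])
    finally show ?thesis .
  qed
  then show ?thesis using cc cac comm by (auto simp: drazin_inverse_def)
qed

lemma (in monoid) drazin_inverse_conjugate:
  assumes a: "a \<in> carrier G" and y: "drazin_inverse G k a y" and x: "x \<in> Units G"
  shows "drazin_inverse G k (inv x \<otimes> a \<otimes> x) (inv x \<otimes> y \<otimes> x)"
proof -
  have "(\<lambda>u. inv x \<otimes> u \<otimes> x) \<in> hom G G"
  proof (rule homI)
    fix u v assume uv: "u \<in> carrier G" "v \<in> carrier G"
    have "x \<otimes> (inv x \<otimes> (v \<otimes> x)) = v \<otimes> x"
      using x uv by (simp add: m_assoc[symmetric] Units_closed)
    then show "inv x \<otimes> (u \<otimes> v) \<otimes> x = (inv x \<otimes> u \<otimes> x) \<otimes> (inv x \<otimes> v \<otimes> x)"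
      using x uv by (simp add: m_assoc Units_closed)
  qed (use x in \<open>simp add: Units_closed\<close>)
  from drazin_inverse_hom[OF monoid_axioms monoid_axioms this _ a y] show ?thesis
    using x by simp
qed

text \<open>
  On the part of \<open>a\<close> that is invertible, \<open>a y\<close> is the identity and \<open>y\<close> inverts \<open>a\<close>; so \<open>a\<close> cut
  down to that part by \<open>a y\<close>, which is \<open>a\<^sup>2 y\<close>, inverts \<open>y\<close>.
\<close>

lemma (in monoid) drazin_inverse_has_group_inverse:
  assumes a: "a \<in> carrier G" and y: "drazin_inverse G k a y"
  shows "drazin_inverse G 1 y (a \<otimes> a \<otimes> y)"
    and "y \<otimes> (a \<otimes> a \<otimes> y) = a \<otimes> y"
proof -
  have yc: "y \<in> carrier G" and yay: "y \<otimes> a \<otimes> y = y" and ay: "a \<otimes> y = y \<otimes> a"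
    using y by (auto simp: drazin_inverse_def)
  have idem: "a \<otimes> (y \<otimes> (a \<otimes> y)) = a \<otimes> y" using yay a yc by (simp add: m_assoc)
  show yw: "y \<otimes> (a \<otimes> a \<otimes> y) = a \<otimes> y"
    using idem a yc ay by (metis m_assoc m_closed)
  have wy: "a \<otimes> a \<otimes> y \<otimes> y = a \<otimes> y"
    using idem a yc ay by (metis m_assoc m_closed)
  have "a \<otimes> y \<otimes> (a \<otimes> a \<otimes> y) = a \<otimes> a \<otimes> y"
    using yw a yc by (simp add: m_assoc)
  moreover have "a \<otimes> y \<otimes> y = y" using yay ay by simp
  ultimately show "drazin_inverse G 1 y (a \<otimes> a \<otimes> y)"
    using a yc yw wy by (simp add: drazin_inverse_def)
qed

section \<open>Stabilising ranks and one-sided factorisations of matrix powers\<close>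

lemma (in vec_space) col_space_mult_subset:
  assumes A: "A \<in> carrier_mat n m" and B: "B \<in> carrier_mat m l"
  shows "col_space (A * B) \<subseteq> col_space A"
proof
  fix y assume "y \<in> col_space (A * B)"
  then obtain x where x: "x \<in> carrier_vec l" and y: "y = A *\<^sub>v (B *\<^sub>v x)"
    using A B by (auto simp: col_space_eq[of _ l])
  then have "B *\<^sub>v x \<in> carrier_vec m" using B by auto
  then show "y \<in> col_space A" using A y by (auto simp: col_space_eq[OF A])
qed

lemma (in vec_space) subspace_col_space:
  assumes A: "A \<in> carrier_mat n m"
  shows "subspace class_ring (col_space A) V"
  unfolding col_space_def using A cols_dim[of A] by (intro span_is_subspace) auto

lemma (in vec_space) fin_dim_col_space:
  assumes A: "A \<in> carrier_mat n m"
  shows "vectorspace.fin_dim class_ring (vs (col_space A))"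
  unfolding col_space_def using fin_dim_span_cols[OF A] .

lemma (in vectorspace) subspace_eq_if_dim_eq:
  assumes W: "subspace K W V" "vectorspace.fin_dim K (vs W)"
    and U: "subspace K U V" "vectorspace.fin_dim K (vs U)"
    and sub: "U \<subseteq> W" and dim: "vectorspace.dim K (vs U) = vectorspace.dim K (vs W)"
  shows "U = W"
proof -
  interpret W: vectorspace K "vs W" using W(1) by (rule subspace_is_vs)
  interpret U: vectorspace K "vs U" using U(1) by (rule subspace_is_vs)
  have subm: "submodule K W V" "submodule K U V"
    using W(1) U(1) by (simp_all add: subspace_def)
  obtain b where b: "finite b" "U.basis b" using U.finite_basis_exists[OF U(2)] by blast
  have bU: "b \<subseteq> U" and "U.lin_indpt b" and "U.gen_set b"
    using b(2) by (auto simp: U.basis_def)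
  have li: "lin_indpt b" and spU: "span b = U"
    using span_li_not_depend[OF bU subm(2)] \<open>U.lin_indpt b\<close> \<open>U.gen_set b\<close> by auto
  have bW: "b \<subseteq> W" using bU sub by blast
  have "W.lin_indpt b" using span_li_not_depend(2)[OF bW subm(1)] li by simp
  moreover have "card b \<ge> W.dim" using U.dim_basis[OF b] dim by simp
  ultimately have "W.basis b"
    using W.dim_li_is_basis[OF W(2) b(1)] bW by simp
  then have "span b = W" using span_li_not_depend(1)[OF bW subm(1)] by (simp add: W.basis_def)
  with spU show ?thesis by simp
qed

lemma (in vec_space) rank_mult_le_left:
  assumes A: "A \<in> carrier_mat n m" and B: "B \<in> carrier_mat m l"
  shows "rank (A * B) \<le> rank A"
proof -
  have AB: "A * B \<in> carrier_mat n l" using A B by simp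
  interpret W: vectorspace class_ring "vs (col_space A)"
    using subspace_col_space[OF A] by (rule subspace_is_vs)
  have "subspace class_ring (col_space (A * B)) (vs (col_space A))"
    using nested_subspaces[OF subspace_col_space[OF A] subspace_col_space[OF AB]
        col_space_mult_subset[OF A B]] .
  from W.subspace_dim[OF this fin_dim_col_space[OF A]] fin_dim_col_space[OF AB]
  show ?thesis by (simp add: rank_def col_space_def)
qed

text \<open>
  Equal ranks force equal column spaces, so each column of \<open>A\<close> is \<open>A B w\<close> for some \<open>w\<close>; these
  vectors are the columns of the factor.
\<close>

lemma (in vec_space) rank_mult_eq_imp_factor:
  assumes A: "A \<in> carrier_mat n m" and B: "B \<in> carrier_mat m l"
    and rank: "rank (A * B) = rank A"
  shows "\<exists>W \<in> carrier_mat l m. A * B * W = A"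
proof -
  have AB: "A * B \<in> carrier_mat n l" using A B by simp
  have eq: "col_space (A * B) = col_space A"
    using subspace_eq_if_dim_eq[OF subspace_col_space[OF A] fin_dim_col_space[OF A]
        subspace_col_space[OF AB] fin_dim_col_space[OF AB] col_space_mult_subset[OF A B]] rank
    by (simp add: rank_def col_space_def)
  have "\<exists>w. w \<in> carrier_vec l \<and> A * B *\<^sub>v w = col A j" if j: "j < m" for j
  proof -
    have "A *\<^sub>v unit_vec m j = col A j" using A j by auto
    then have "col A j \<in> col_space A" using A j unfolding col_space_eq[OF A] by auto
    then show ?thesis using AB B unfolding eq[symmetric] col_space_eq[OF AB] by auto
  qed
  then obtain w where w: "\<And>j. j < m \<Longrightarrow> w j \<in> carrier_vec l"
    and eqw: "\<And>j. j < m \<Longrightarrow> A * B *\<^sub>v w j = col A j" by metis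
  define W where "W = mat_of_cols l (map w [0..<m])"
  have W: "W \<in> carrier_mat l m" unfolding W_def using mat_of_cols_carrier(1)[of l "map w [0..<m]"] by simp
  have "A * B * W = A"
  proof (rule mat_col_eqI)
    fix j assume "j < dim_col A"
    then have j: "j < m" using A by simp
    have "col W j = w j" using w[OF j] j by (simp add: W_def)
    then show "col (A * B * W) j = col A j" using eqw[OF j] AB W j by (subst col_mult2) auto
  qed (use A B W in auto)
  with W show ?thesis by blast
qed

lemma antimono_nat_seq_stalls:
  fixes f :: "nat \<Rightarrow> nat"
  assumes "\<And>k. f (k + 1) \<le> f k"
  shows "\<exists>k>0. f k = f (k + 1)"
proof (rule ccontr)
  assume "\<not> ?thesis"
  then have less: "f (k + 1) < f k" if "k > 0" for k using assms[of k] that by (metis le_neq_implies_less)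
  have "f (j + 1) + j \<le> f 1" for j
  proof (induction j)
    case (Suc j) then show ?case using less[of "j + 1"] by simp
  qed simp
  from this[of "Suc (f 1)"] show False by simp
qed

text \<open>
  This makes the index of a matrix a genuine minimum.
\<close>

lemma rank_powers_stall:
  fixes M :: "'a::field mat"
  assumes M: "M \<in> carrier_mat N N"
  shows "\<exists>k>0. vec_space.rank N (M ^\<^sub>m k) = vec_space.rank N (M ^\<^sub>m (k + 1))"
  by (rule antimono_nat_seq_stalls) (use vec_space.rank_mult_le_left[of _ N N M N] M in simp)

lemma mat_index_factor:
  assumes M: "M \<in> carrier_mat N N"
  shows "\<exists>W \<in> carrier_mat N N. M ^\<^sub>m Suc (mat_index M) * W = M ^\<^sub>m mat_index M"
proof -
  have "vec_space.rank N (M ^\<^sub>m mat_index M) = vec_space.rank N (M ^\<^sub>m (mat_index M + 1))"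
    using LeastI_ex[OF rank_powers_stall[OF M]] M unfolding mat_index_def by simp
  then show ?thesis
    using vec_space.rank_mult_eq_imp_factor[of "M ^\<^sub>m mat_index M" N N M N] M by simp
qed

lemma transpose_pow_mat:
  fixes M :: "'a::comm_semiring_1 mat"
  assumes M: "M \<in> carrier_mat N N"
  shows "(M ^\<^sub>m k)\<^sup>T = M\<^sup>T ^\<^sub>m k"
proof (induction k)
  case (Suc k)
  have comm: "M * M ^\<^sub>m k = M ^\<^sub>m k * M"
  proof (induction k)
    case (Suc k)
    then show ?case using M by (simp add: assoc_mult_mat[of _ N N _ N _ N, symmetric])
  qed (use M in simp)
  then have "(M ^\<^sub>m Suc k)\<^sup>T = (M * M ^\<^sub>m k)\<^sup>T" by simp
  also have "\<dots> = (M ^\<^sub>m k)\<^sup>T * M\<^sup>T" using M by (intro transpose_mult) auto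
  finally show ?case by (simp add: Suc)
qed (use M in simp)

text \<open>
  Transposition exchanges left and right factors, so the index of the transpose serves as exponent.
\<close>

lemma pow_left_factor:
  fixes M :: "complex mat"
  assumes M: "M \<in> carrier_mat N N"
  shows "\<exists>l. \<exists>W \<in> carrier_mat N N. W * M ^\<^sub>m Suc l = M ^\<^sub>m l"
proof -
  have MT: "M\<^sup>T \<in> carrier_mat N N" using M by simp
  obtain W where W: "W \<in> carrier_mat N N"
    and eq: "M\<^sup>T ^\<^sub>m Suc (mat_index M\<^sup>T) * W = M\<^sup>T ^\<^sub>m mat_index M\<^sup>T"
    using mat_index_factor[OF MT] by blast
  let ?l = "mat_index M\<^sup>T"
  have "W\<^sup>T * M ^\<^sub>m Suc ?l = ((M ^\<^sub>m Suc ?l)\<^sup>T * W)\<^sup>T"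
    using transpose_mult[of "(M ^\<^sub>m Suc ?l)\<^sup>T" N N W N] pow_carrier_mat[OF M, of "Suc ?l"] W
    by (simp del: pow_mat.simps)
  also have "\<dots> = M ^\<^sub>m ?l"
    by (simp only: transpose_pow_mat[OF M] eq) (simp add: transpose_pow_mat[OF M, symmetric])
  finally show ?thesis using W by (intro exI[of _ ?l] bexI[of _ "W\<^sup>T"]) simp_all
qed

section \<open>Block circulant matrices as fixed points of the block shift\<close>

text \<open>
  For a square matrix this is conjugation by the permutation matrix of the cyclic shift of indices by
  \<open>n\<close>, the size of a block. Written entrywise, its multiplicativity is a reindexing of a sum.
\<close>

definition block_shift :: "nat \<Rightarrow> 'a mat \<Rightarrow> 'a mat" where
  "block_shift n M = mat (dim_row M) (dim_col M)
     (\<lambda>(i, j). M $$ ((i + n) mod dim_row M, (j + n) mod dim_col M))"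

definition block_circulant :: "nat \<Rightarrow> nat \<Rightarrow> 'a mat \<Rightarrow> bool" where
  "block_circulant n p M \<longleftrightarrow> M \<in> carrier_mat (n * p) (n * p) \<and> block_shift n M = M"

definition first_block_column :: "nat \<Rightarrow> 'a mat \<Rightarrow> 'a mat" where
  "first_block_column n M = mat (dim_row M) n (\<lambda>(i, j). M $$ (i, j))"

lemma inj_on_add_mod: "inj_on (\<lambda>i. (i + n) mod N) {..<N :: nat}"
proof (rule inj_onI)
  fix i j assume ij: "i \<in> {..<N}" "j \<in> {..<N}" and eq: "(i + n) mod N = (j + n) mod N"
  have "(k + n) mod N = (if k + n mod N < N then k + n mod N else k + n mod N - N)" if "k < N" for k
  proof -
    have "n mod N < N" using that by simp
    then have "k + n mod N - N < N" using that by linarith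
    then show ?thesis
      using mod_add_right_eq[of k n N] by (simp add: mod_if[of "k + n mod N"] split: if_splits)
  qed
  from this[of i] this[of j] eq ij show "i = j" by (auto split: if_splits)
qed

lemma bij_betw_add_mod:
  assumes "0 < N" shows "bij_betw (\<lambda>i. (i + n) mod N) {..<N :: nat} {..<N}"
  unfolding bij_betw_def
  using inj_on_add_mod[of n N] assms by (intro conjI endo_inj_surj) auto

lemma block_shift_carrier: "M \<in> carrier_mat r c \<Longrightarrow> block_shift n M \<in> carrier_mat r c"
  by (auto simp: block_shift_def)

lemma block_shift_mult:
  fixes A B :: "'a::semiring_0 mat"
  assumes A: "A \<in> carrier_mat N N" and B: "B \<in> carrier_mat N N"
  shows "block_shift n (A * B) = block_shift n A * block_shift n B"
proof (rule eq_matI)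
  fix i j assume "i < dim_row (block_shift n A * block_shift n B)"
    and "j < dim_col (block_shift n A * block_shift n B)"
  then have i: "i < N" and j: "j < N" and N: "0 < N" using A B by (auto simp: block_shift_def)
  let ?s = "\<lambda>i. (i + n) mod N"
  have "block_shift n (A * B) $$ (i, j) = (\<Sum>k<N. A $$ (?s i, k) * B $$ (k, ?s j))"
    using A B i j N by (simp add: block_shift_def scalar_prod_def atLeast0LessThan)
  also have "\<dots> = (\<Sum>k<N. A $$ (?s i, ?s k) * B $$ (?s k, ?s j))"
    using sum.reindex_bij_betw[OF bij_betw_add_mod[OF N, of n],
        of "\<lambda>k. A $$ (?s i, k) * B $$ (k, ?s j)"] by simp
  also have "\<dots> = (block_shift n A * block_shift n B) $$ (i, j)"
    using A B i j by (simp add: block_shift_def scalar_prod_def atLeast0LessThan)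
  finally show "block_shift n (A * B) $$ (i, j) = (block_shift n A * block_shift n B) $$ (i, j)" .
qed (use A B in \<open>simp_all add: block_shift_def\<close>)

lemma block_shift_one: "block_shift n (1\<^sub>m N) = (1\<^sub>m N :: 'a::{zero,one} mat)"
proof (rule eq_matI)
  fix i j assume "i < dim_row (1\<^sub>m N :: 'a mat)" "j < dim_col (1\<^sub>m N :: 'a mat)"
  then have ij: "i < N" "j < N" by simp_all
  then have "(i + n) mod N = (j + n) mod N \<longleftrightarrow> i = j"
    using inj_on_eq_iff[OF inj_on_add_mod[of n N]] by simp
  then show "block_shift n (1\<^sub>m N) $$ (i, j) = (1\<^sub>m N :: 'a mat) $$ (i, j)"
    using ij by (simp add: block_shift_def)
qed (simp_all add: block_shift_def)

lemma block_circulant_mult: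
  fixes A B :: "'a::semiring_0 mat"
  assumes "block_circulant n p A" "block_circulant n p B"
  shows "block_circulant n p (A * B)"
  using assms block_shift_mult[of A "n * p" B n] mult_carrier_mat[of A "n * p" "n * p" B "n * p"]
  by (simp add: block_circulant_def)

lemma block_circulant_one: "block_circulant n p (1\<^sub>m (n * p))"
  by (simp add: block_circulant_def block_shift_one)

text \<open>
  Shifting back by one block moves column \<open>j\<close> to column \<open>j - n\<close>, so by induction every entry of a
  block circulant matrix equals an entry of its first block column.
\<close>

lemma block_circulant_eqI:
  assumes M: "block_circulant n p M" and L: "block_circulant n p L"
    and col: "first_block_column n M = first_block_column n L"
    and np: "0 < n" "0 < p"
  shows "M = L"
proof -
  let ?N = "n * p"
  have Mc: "M \<in> carrier_mat ?N ?N" and Lc: "L \<in> carrier_mat ?N ?N"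
    using M L by (auto simp: block_circulant_def)
  have shift: "K $$ ((i + n) mod ?N, (j + n) mod ?N) = K $$ (i, j)"
    if K: "block_circulant n p K" and "i < ?N" "j < ?N" for K i j
  proof -
    have "K \<in> carrier_mat ?N ?N" and "block_shift n K = K" using K by (auto simp: block_circulant_def)
    then have "K $$ (i, j) = block_shift n K $$ (i, j)" by simp
    then show ?thesis using that \<open>K \<in> carrier_mat ?N ?N\<close> by (simp add: block_shift_def)
  qed
  have eq: "M $$ (i, j) = L $$ (i, j)" if "i < ?N" "j < ?N" for i j
    using that
  proof (induction j arbitrary: i rule: less_induct)
    case (less j)
    show ?case
    proof (cases "j < n")
      case True
      have "first_block_column n M $$ (i, j) = first_block_column n L $$ (i, j)" by (simp only: col)
      then show ?thesis using True less.prems Mc Lc by (simp add: first_block_column_def)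
    next
      case False
      \<comment> \<open>the row one block above \<open>i\<close>, cyclically; adding \<open>?N - n\<close> avoids truncated subtraction\<close>
      define i' where "i' = (i + (?N - n)) mod ?N"
      have "n \<le> ?N" using np by simp
      then have "i + (?N - n) + n = i + ?N" by linarith
      then have i': "(i' + n) mod ?N = i" "i' < ?N"
        using less.prems np by (simp_all add: i'_def mod_add_left_eq)
      have j': "(j - n + n) mod ?N = j" "j - n < ?N" "j - n < j" using False less.prems np by auto
      show ?thesis
        using less.IH[OF j'(3) i'(2) j'(2)] shift[OF M i'(2) j'(2)] shift[OF L i'(2) j'(2)]
        by (simp only: i'(1) j'(1))
    qed
  qed
  show ?thesis by (rule eq_matI) (use eq Mc Lc in auto)
qed

section \<open>The embedding of tensors into matrices\<close>

lemma carrier_tensor_dims: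
  assumes A: "A \<in> carrier_tensor m n p" and p: "0 < p"
  shows "t_rows A = m" "t_cols A = n" "length A = p"
proof -
  have "A \<noteq> []" using A p by (auto simp: carrier_tensor_def)
  then have "hd A \<in> carrier_mat m n" using A by (auto simp: carrier_tensor_def)
  then show "t_rows A = m" "t_cols A = n" by (auto simp: t_rows_def t_cols_def)
  show "length A = p" using A by (simp add: carrier_tensor_def)
qed

lemma t_fold_carrier: "M \<in> carrier_mat (m * p) n \<Longrightarrow> t_fold m p M \<in> carrier_tensor m n p"
  by (auto simp: t_fold_def carrier_tensor_def)

lemma bcirc_carrier:
  assumes "A \<in> carrier_tensor m n p" "0 < p"
  shows "bcirc A \<in> carrier_mat (m * p) (n * p)"
  using carrier_tensor_dims[OF assms] by (simp add: bcirc_def Let_def)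

lemma block_circulant_bcirc:
  assumes A: "A \<in> carrier_tensor n n p" and np: "0 < n" "0 < p"
  shows "block_circulant n p (bcirc A)"
proof -
  note dims = carrier_tensor_dims[OF A np(2)]
  have shift: "((i + n) mod (n * p)) div n = Suc (i div n) mod p" "((i + n) mod (n * p)) mod n = i mod n" for i
    using np by (simp_all add: mod_mult2_eq)
  have mod: "(int (Suc a mod p) - int (Suc b mod p)) mod int p = (int a - int b) mod int p" for a b
    by (simp add: of_nat_mod mod_diff_eq)
  have "block_shift n (bcirc A) = bcirc A"
    using np by (intro eq_matI) (auto simp: block_shift_def bcirc_def Let_def dims shift mod)
  then show ?thesis using bcirc_carrier[OF A np(2)] by (simp add: block_circulant_def)
qed

lemma first_block_column_bcirc:
  assumes A: "A \<in> carrier_tensor n n p" and np: "0 < n" "0 < p"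
  shows "first_block_column n (bcirc A) = t_unfold A"
proof -
  note dims = carrier_tensor_dims[OF A np(2)]
  have "j < n * p" if "j < n" for j using less_le_trans[OF that, of "n * p"] np by simp
  then show ?thesis
    using np by (intro eq_matI)
      (auto simp: first_block_column_def bcirc_def t_unfold_def Let_def dims less_mult_imp_div_less mult.commute)
qed

text \<open>
  Together with \<open>block_circulant_bcirc\<close> this identifies the range of \<open>bcirc\<close>: every block circulant
  matrix is the image of the tensor folded from its first block column.
\<close>

lemma bcirc_fold:
  assumes M: "block_circulant n p M" and np: "0 < n" "0 < p"
  shows "t_fold n p (first_block_column n M) \<in> carrier_tensor n n p"
    and "bcirc (t_fold n p (first_block_column n M)) = M"
proof -
  have fc: "first_block_column n M \<in> carrier_mat (n * p) n"
    using M by (intro carrier_matI) (auto simp: block_circulant_def first_block_column_def)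
  show c: "t_fold n p (first_block_column n M) \<in> carrier_tensor n n p"
    using t_fold_carrier[OF fc] .
  show "bcirc (t_fold n p (first_block_column n M)) = M"
    using block_circulant_eqI[OF block_circulant_bcirc[OF c np] M _ np]
    by (simp add: first_block_column_bcirc[OF c np] t_unfold_fold[OF fc np(2)])
qed

lemma inj_on_bcirc:
  assumes np: "0 < n" "0 < p"
  shows "inj_on bcirc (carrier_tensor n n p)"
  by (rule inj_on_inverseI[of _ "\<lambda>M. t_fold n p (first_block_column n M)"])
    (simp add: first_block_column_bcirc[OF _ np] t_fold_unfold[OF _ np(2)])

text \<open>
  The T-product is folded from \<open>bcirc A * t_unfold B\<close>, which is the first block column of
  \<open>bcirc A * bcirc B\<close>. That product is block circulant, hence determined by this column.
\<close>

lemma bcirc_t_prod: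
  assumes A: "A \<in> carrier_tensor n n p" and B: "B \<in> carrier_tensor n n p"
    and np: "0 < n" "0 < p"
  shows "A *\<^sub>T B \<in> carrier_tensor n n p" and "bcirc (A *\<^sub>T B) = bcirc A * bcirc B"
proof -
  have cA: "bcirc A \<in> carrier_mat (n * p) (n * p)" and cB: "bcirc B \<in> carrier_mat (n * p) (n * p)"
    using bcirc_carrier[OF _ np(2)] A B by auto
  have "j < n * p" if "j < n" for j using less_le_trans[OF that, of "n * p"] np by simp
  then have "first_block_column n (bcirc A * bcirc B) = bcirc A * first_block_column n (bcirc B)"
    using cA cB by (intro eq_matI) (auto simp: first_block_column_def scalar_prod_def)
  then have prod: "A *\<^sub>T B = t_fold n p (first_block_column n (bcirc A * bcirc B))"
    using carrier_tensor_dims[OF A np(2)]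
    by (simp add: t_prod_def first_block_column_bcirc[OF B np])
  have "block_circulant n p (bcirc A * bcirc B)"
    using A B np by (intro block_circulant_mult block_circulant_bcirc)
  from bcirc_fold[OF this np]
  show "A *\<^sub>T B \<in> carrier_tensor n n p" and "bcirc (A *\<^sub>T B) = bcirc A * bcirc B"
    by (simp_all add: prod)
qed

lemma bcirc_t_one:
  assumes np: "0 < n" "0 < p"
  shows "t_one n p \<in> carrier_tensor n n p" and "bcirc (t_one n p) = 1\<^sub>m (n * p)"
proof -
  show c: "t_one n p \<in> carrier_tensor n n p"
    by (auto simp: t_one_def carrier_tensor_def)
  note dims = carrier_tensor_dims[OF c np(2)]
  have "t_unfold (t_one n p) = first_block_column n (1\<^sub>m (n * p))"
  proof (rule eq_matI)
    fix i j assume "i < dim_row (first_block_column n (1\<^sub>m (n * p)))"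
      and "j < dim_col (first_block_column n (1\<^sub>m (n * p)))"
    then have i: "i < n * p" and j: "j < n" by (simp_all add: first_block_column_def)
    have "n \<le> n * p" using np by simp
    with j have j': "j < n * p" by (rule less_le_trans)
    have blk: "i div n < p" using i by (simp add: less_mult_imp_div_less mult.commute)
    show "t_unfold (t_one n p) $$ (i, j) = first_block_column n (1\<^sub>m (n * p)) $$ (i, j)"
    proof (cases "i < n")
      case True
      then show ?thesis using i j j' np blk
        by (simp add: t_unfold_def Let_def dims first_block_column_def) (simp add: t_one_def)
    next
      case False
      then have "i div n \<noteq> 0" "i \<noteq> j" using np j by (auto simp: div_eq_0_iff)
      then show ?thesis using i j j' np blk
        by (simp add: t_unfold_def Let_def dims first_block_column_def) (simp add: t_one_def)
    qed
  qed (simp_all add: t_unfold_def Let_def dims first_block_column_def)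
  then show "bcirc (t_one n p) = 1\<^sub>m (n * p)"
    using block_circulant_eqI[OF block_circulant_bcirc[OF c np] block_circulant_one _ np]
    by (simp add: first_block_column_bcirc[OF c np])
qed

section \<open>T-Drazin inverses\<close>

abbreviation mat_monoid :: "nat \<Rightarrow> complex mat ring" where
  "mat_monoid N \<equiv> ring_mat TYPE(complex) N ()"

lemma monoid_ring_mat: "monoid (mat_monoid N)"
  using semiring_mat[of N "()", where 'a = complex] by (rule semiring.axioms(2))

lemma t_monoid_simps [simp]:
  "carrier (t_monoid n p) = carrier_tensor n n p"
  "A \<otimes>\<^bsub>t_monoid n p\<^esub> B = A *\<^sub>T B"
  "\<one>\<^bsub>t_monoid n p\<^esub> = t_one n p"
  by (simp_all add: t_monoid_def)

lemma bcirc_hom: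
  assumes np: "0 < n" "0 < p"
  shows "bcirc \<in> hom (t_monoid n p) (mat_monoid (n * p))"
  by (rule homI) (simp_all add: ring_mat_simps bcirc_carrier[OF _ np(2)] bcirc_t_prod(2)[OF _ _ np])

lemma monoid_t_monoid:
  assumes np: "0 < n" "0 < p"
  shows "monoid (t_monoid n p)"
proof -
  note closed = bcirc_t_prod(1)[OF _ _ np] bcirc_t_one(1)[OF np]
  note bcirc = bcirc_t_prod(2)[OF _ _ np] bcirc_t_one(2)[OF np] bcirc_carrier[OF _ np(2)]
  note eqI = inj_onD[OF inj_on_bcirc[OF np]]
  show ?thesis
  proof (rule monoidI, unfold t_monoid_simps)
    fix A B C
    assume A: "A \<in> carrier_tensor n n p" and B: "B \<in> carrier_tensor n n p"
    show "A *\<^sub>T B \<in> carrier_tensor n n p" using A B by (rule closed)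
    show "t_one n p *\<^sub>T A = A" "A *\<^sub>T t_one n p = A"
      using A left_mult_one_mat[OF bcirc(3)[OF A]] right_mult_one_mat[OF bcirc(3)[OF A]]
      by (auto intro!: eqI simp: closed bcirc(1,2))
    assume C: "C \<in> carrier_tensor n n p"
    have "bcirc A * bcirc B * bcirc C = bcirc A * (bcirc B * bcirc C)"
      using A B C by (intro assoc_mult_mat) (auto intro: bcirc)
    then show "A *\<^sub>T B *\<^sub>T C = A *\<^sub>T (B *\<^sub>T C)"
      using A B C by (auto intro!: eqI simp: closed bcirc)
  qed (rule closed)
qed

lemma is_t_drazin_iff:
  "is_t_drazin n p A Y \<longleftrightarrow> drazin_inverse (t_monoid n p) (t_index A) A Y"
  by (simp add: is_t_drazin_def drazin_inverse_def Let_def)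

text \<open>
  The group inverse is the Drazin inverse with exponent 1, so that uniqueness and existence for both
  come from the same facts about monoids.
\<close>

lemma is_t_group_inverse_iff:
  assumes np: "0 < n" "0 < p" and A: "A \<in> carrier_tensor n n p"
  shows "is_t_group_inverse n p A Y \<longleftrightarrow> drazin_inverse (t_monoid n p) 1 A Y"
proof -
  interpret monoid "t_monoid n p" using np by (rule monoid_t_monoid)
  have "A [^]\<^bsub>t_monoid n p\<^esub> (1::nat) = A" using A l_one[of A] by simp
  then show ?thesis by (simp only: is_t_group_inverse_def drazin_inverse_def t_monoid_simps)
qed

lemma mat_drazin_inverse_exists:
  assumes M: "M \<in> carrier_mat N N"
  shows "\<exists>Y. drazin_inverse (mat_monoid N) (mat_index M) M Y"
proof -
  interpret monoid "mat_monoid N" by (rule monoid_ring_mat)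
  obtain W where "W \<in> carrier_mat N N" "M ^\<^sub>m Suc (mat_index M) * W = M ^\<^sub>m mat_index M"
    using mat_index_factor[OF M] by blast
  moreover obtain V l where "V \<in> carrier_mat N N" "V * M ^\<^sub>m Suc l = M ^\<^sub>m l"
    using pow_left_factor[OF M] by blast
  ultimately show ?thesis
    using drazin_inverse_exists[of M W V "mat_index M" l] M
    by (simp only: pow_mat_ring_pow[OF M, of _ "()"] ring_mat_simps)
qed

text \<open>
  The matrix \<open>bcirc A\<close> has a Drazin inverse \<open>Y\<close>. The block shift fixes \<open>bcirc A\<close> and is a monoid
  homomorphism, so the shifted \<open>Y\<close> is again a Drazin inverse of \<open>bcirc A\<close> and coincides with \<open>Y\<close>.
  Thus \<open>Y\<close> is block circulant, and the tensor that it comes from is the required inverse.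
\<close>

lemma is_t_drazin_exists:
  assumes np: "0 < n" "0 < p" and A: "A \<in> carrier_tensor n n p"
  shows "\<exists>Y. is_t_drazin n p A Y"
proof -
  let ?R = "mat_monoid (n * p)"
  interpret R: monoid ?R by (rule monoid_ring_mat)
  have M: "bcirc A \<in> carrier_mat (n * p) (n * p)" using A np(2) by (rule bcirc_carrier)
  obtain Y where Y: "drazin_inverse ?R (t_index A) (bcirc A) Y"
    using mat_drazin_inverse_exists[OF M] by (auto simp: t_index_def)
  then have Yc: "Y \<in> carrier_mat (n * p) (n * p)" by (simp add: drazin_inverse_def ring_mat_simps)
  have "block_shift n \<in> hom ?R ?R"
    by (rule homI) (auto simp: ring_mat_simps block_shift_mult intro: block_shift_carrier)
  from drazin_inverse_hom[OF R.monoid_axioms R.monoid_axioms this _ _ Y]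
  have "drazin_inverse ?R (t_index A) (bcirc A) (block_shift n Y)"
    using block_circulant_bcirc[OF A np] M
    by (simp add: ring_mat_simps block_shift_one block_circulant_def)
  then have "block_shift n Y = Y"
    by (rule R.drazin_inverse_unique[rotated, OF _ Y]) (simp add: ring_mat_simps M)
  then have circ: "block_circulant n p Y" using Yc by (simp add: block_circulant_def)
  from bcirc_fold[OF circ np] obtain T where T: "T \<in> carrier_tensor n n p" "bcirc T = Y" by blast
  have "drazin_inverse (t_monoid n p) (t_index A) A T"
    using drazin_inverse_hom_iff[OF monoid_t_monoid[OF np] R.monoid_axioms bcirc_hom[OF np],
        of A T "t_index A"] T A Y inj_on_bcirc[OF np]
    by (simp add: ring_mat_simps bcirc_t_one(2)[OF np])
  then show ?thesis by (auto simp: is_t_drazin_iff)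
qed

lemma is_t_drazin_t_drazin:
  assumes np: "0 < n" "0 < p" and A: "A \<in> carrier_tensor n n p"
  shows "is_t_drazin n p A (t_drazin n p A)"
proof -
  interpret monoid "t_monoid n p" using np by (rule monoid_t_monoid)
  obtain T where T: "is_t_drazin n p A T" using is_t_drazin_exists[OF np A] by blast
  have "Y = T" if "is_t_drazin n p A Y" for Y
    using drazin_inverse_unique[of A] A that T unfolding is_t_drazin_iff t_monoid_simps by blast
  with T show ?thesis unfolding t_drazin_def by (rule theI)
qed

theorem corollary9:
  fixes n p :: nat and A B X :: tensor
  assumes "n \<ge> 1" and "p \<ge> 1"
    and "A \<in> carrier_tensor n n p" and "B \<in> carrier_tensor n n p"
    and "X \<in> Units (t_monoid n p)"
    and "A = inv\<^bsub>t_monoid n p\<^esub> X *\<^sub>T B *\<^sub>T X"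
  shows "t_drazin n p A = inv\<^bsub>t_monoid n p\<^esub> X *\<^sub>T t_drazin n p B *\<^sub>T X
    \<and> (\<exists>!Y. is_t_group_inverse n p (t_drazin n p A) Y)
    \<and> t_drazin n p A *\<^sub>T t_group_inverse n p (t_drazin n p A) = A *\<^sub>T t_drazin n p A"
proof -
  let ?G = "t_monoid n p"
  let ?D = "t_drazin n p A"
  have np: "0 < n" "0 < p" using assms(1,2) by auto
  interpret G: monoid ?G using np by (rule monoid_t_monoid)
  have A: "A \<in> carrier ?G" and B: "B \<in> carrier ?G" using assms(3,4) by simp_all
  have DA: "drazin_inverse ?G (t_index A) A ?D"
    and DB: "drazin_inverse ?G (t_index B) B (t_drazin n p B)"
    using is_t_drazin_t_drazin[OF np] assms(3,4) by (simp_all add: is_t_drazin_iff)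
  \<comment> \<open>the conjugate is a Drazin inverse of \<open>A\<close> with exponent \<open>t_index B\<close>, not \<open>t_index A\<close>\<close>
  have similar: "?D = inv\<^bsub>?G\<^esub> X *\<^sub>T t_drazin n p B *\<^sub>T X"
    using G.drazin_inverse_unique[OF A DA] G.drazin_inverse_conjugate[OF B DB assms(5)] assms(6)
    by simp
  have D: "?D \<in> carrier ?G" using DA by (simp add: drazin_inverse_def)
  let ?W = "A *\<^sub>T A *\<^sub>T ?D"
  have W: "drazin_inverse ?G 1 ?D ?W" and prod: "?D *\<^sub>T ?W = A *\<^sub>T ?D"
    using G.drazin_inverse_has_group_inverse[OF A DA] by simp_all
  have group: "is_t_group_inverse n p ?D Y \<longleftrightarrow> Y = ?W" for Y
    using is_t_group_inverse_iff[OF np, of ?D Y] D G.drazin_inverse_unique[OF D _ W, of 1 Y] W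
    unfolding t_monoid_simps by blast
  then have "t_group_inverse n p ?D = ?W" by (simp add: t_group_inverse_def)
  with similar group prod show ?thesis by simp
qed

end
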